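(* Let $\mathbb{F}$ be a field and let $L$ be a Heisenberg Lie algebra over $\mathbb{F}$ of dimension $n$, where $n \geq 5$, such that $[L : Z(L)] \geq 4$. Then $\mathcal{A}(L)$ is not a subgroup of $Aut(L)$.
   Context: $Z(L)=\{x\in L : [x,y]=0 \ \forall y\in L\}$ is the center of $L$, and $L'=[L,L]$ is the derived subalgebra. For subspaces $B\subseteq A$ of $L$, $[A:B]$ denotes $\dim (A/B)$. A Heisenberg Lie algebra here means a finite-dimensional Lie algebra $L$ with $\dim L'=1$ and $L'\subseteq Z(L)$ (so the center may be larger than $L'$). $Aut(L)$ is the group of Lie algebra automorphisms of $L$ under composition. An automorphism $\alpha\in Aut(L)$ is called commuting if $[\alpha(x),x]=0$ for all $x\in L$; $\mathcal{A}(L)=\{\alpha\in Aut(L) : [\alpha(x),x]=0 \ \forall x\in L\}$ is the set of commuting automorphisms. *)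

theory Defs
  imports "HOL-Algebra.Bij" "HOL-Algebra.AbelCoset" "Jordan_Normal_Form.Missing_VectorSpace"
begin

text \<open>
  A Lie algebra is a vector space record over a field, extended by a bracket. The fields
  \<open>mult\<close> and \<open>one\<close> that every module record inherits from \<open>ring\<close> carry no meaning here.
\<close>

record ('a, 'b) lie_algebra = "('a, 'b) module" +
  bracket :: "'b \<Rightarrow> 'b \<Rightarrow> 'b"

locale lie_algebra = vectorspace F L
  for F :: "('a, 'c) ring_scheme" and L :: "('a, 'b, 'd) lie_algebra_scheme" (structure) +
  assumes bracket_closed:
      "\<lbrakk>x \<in> carrier L; y \<in> carrier L\<rbrakk> \<Longrightarrow> bracket L x y \<in> carrier L"
    and bracket_add_left:
      "\<lbrakk>x \<in> carrier L; y \<in> carrier L; z \<in> carrier L\<rbrakk>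
        \<Longrightarrow> bracket L (x \<oplus>\<^bsub>L\<^esub> y) z = bracket L x z \<oplus>\<^bsub>L\<^esub> bracket L y z"
    and bracket_add_right:
      "\<lbrakk>x \<in> carrier L; y \<in> carrier L; z \<in> carrier L\<rbrakk>
        \<Longrightarrow> bracket L x (y \<oplus>\<^bsub>L\<^esub> z) = bracket L x y \<oplus>\<^bsub>L\<^esub> bracket L x z"
    and bracket_smult_left:
      "\<lbrakk>a \<in> carrier F; x \<in> carrier L; y \<in> carrier L\<rbrakk>
        \<Longrightarrow> bracket L (a \<odot>\<^bsub>L\<^esub> x) y = a \<odot>\<^bsub>L\<^esub> bracket L x y"
    and bracket_smult_right:
      "\<lbrakk>a \<in> carrier F; x \<in> carrier L; y \<in> carrier L\<rbrakk>
        \<Longrightarrow> bracket L x (a \<odot>\<^bsub>L\<^esub> y) = a \<odot>\<^bsub>L\<^esub> bracket L x y"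
    and bracket_self: "x \<in> carrier L \<Longrightarrow> bracket L x x = \<zero>\<^bsub>L\<^esub>"
    and jacobi:
      "\<lbrakk>x \<in> carrier L; y \<in> carrier L; z \<in> carrier L\<rbrakk>
        \<Longrightarrow> bracket L x (bracket L y z) \<oplus>\<^bsub>L\<^esub> bracket L y (bracket L z x)
              \<oplus>\<^bsub>L\<^esub> bracket L z (bracket L x y) = \<zero>\<^bsub>L\<^esub>"

definition lie_center :: "('a, 'b, 'd) lie_algebra_scheme \<Rightarrow> 'b set" where
  "lie_center L = {x \<in> carrier L. \<forall>y \<in> carrier L. bracket L x y = \<zero>\<^bsub>L\<^esub>}"

definition derived_subalgebra ::
    "('a, 'c) ring_scheme \<Rightarrow> ('a, 'b, 'd) lie_algebra_scheme \<Rightarrow> 'b set" where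
  "derived_subalgebra F L =
     module.span F L {bracket L x y | x y. x \<in> carrier L \<and> y \<in> carrier L}"

text \<open>
  The quotient \<open>V / W\<close>, with cosets as elements. In the scalar action, all the cosets
  \<open>W + a x\<close> for \<open>x \<in> X\<close> coincide when \<open>W\<close> is a subspace and \<open>X\<close> a coset of it; the union is that
  common value (also for \<open>a = 0\<close>, where the pointwise multiple of \<open>X\<close> would not be a coset).
\<close>

definition quotient_space :: "('a, 'b, 'd) module_scheme \<Rightarrow> 'b set \<Rightarrow> ('a, 'b set) module" where
  "quotient_space V W =
     \<lparr>carrier = a_rcosets\<^bsub>V\<^esub> W, mult = undefined, one = undefined,
      zero = W, add = set_add V,
      smult = (\<lambda>a X. \<Union>x\<in>X. W +>\<^bsub>V\<^esub> (a \<odot>\<^bsub>V\<^esub> x))\<rparr>"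

definition subspace_index ::
    "('a, 'c) ring_scheme \<Rightarrow> ('a, 'b, 'd) module_scheme \<Rightarrow> 'b set \<Rightarrow> 'b set \<Rightarrow> nat" where
  "subspace_index F V A B = vectorspace.dim F (quotient_space (V\<lparr>carrier := A\<rparr>) B)"

locale heisenberg_lie_algebra = lie_algebra +
  assumes finite_dimensional: "fin_dim"
    and dim_derived: "vectorspace.dim F (L\<lparr>carrier := derived_subalgebra F L\<rparr>) = 1"
    and derived_central: "derived_subalgebra F L \<subseteq> lie_center L"

text \<open>
  As in \<open>AutoGroup\<close>, automorphisms are extensional on the carrier, so that equality of
  automorphisms is equality of functions.
\<close>

definition lie_auto ::
    "('a, 'c) ring_scheme \<Rightarrow> ('a, 'b, 'd) lie_algebra_scheme \<Rightarrow> ('b \<Rightarrow> 'b) set" where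
  "lie_auto F L =
     {\<alpha> \<in> module_hom F L L \<inter> Bij (carrier L).
        \<forall>x \<in> carrier L. \<forall>y \<in> carrier L. \<alpha> (bracket L x y) = bracket L (\<alpha> x) (\<alpha> y)}"

definition LieAutoGroup ::
    "('a, 'c) ring_scheme \<Rightarrow> ('a, 'b, 'd) lie_algebra_scheme \<Rightarrow> ('b \<Rightarrow> 'b) monoid" where
  "LieAutoGroup F L = BijGroup (carrier L) \<lparr>carrier := lie_auto F L\<rparr>"

definition commuting_autos ::
    "('a, 'c) ring_scheme \<Rightarrow> ('a, 'b, 'd) lie_algebra_scheme \<Rightarrow> ('b \<Rightarrow> 'b) set" where
  "commuting_autos F L =
     {\<alpha> \<in> lie_auto F L. \<forall>x \<in> carrier L. bracket L (\<alpha> x) x = \<zero>\<^bsub>L\<^esub>}"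

end

theory Submission
  imports Defs
begin

text \<open>
  Write \<open>[u, v] = f u v w\<close> with \<open>w\<close> spanning \<open>L'\<close>. Whenever \<open>f p q = 2\<close>, the map
  \<open>u \<mapsto> u + f u p q + f q u p\<close> negates \<open>f _ p\<close> and \<open>f _ q\<close>, hence is an involution; it preserves
  \<open>f\<close> and satisfies \<open>f (\<alpha> u) u = 0\<close>, in every characteristic. Fix \<open>x, p\<close> with \<open>f x p = 1\<close>.
  As \<open>[L : Z(L)] > 2\<close>, there are \<open>a, b\<close> orthogonal to \<open>x\<close> and \<open>p\<close> with \<open>f a b \<noteq> 0\<close>. Let \<open>\<alpha>\<close> and
  \<open>\<beta>\<close> be the involutions of \<open>(p, a - 2x)\<close> and \<open>(p, b - 2x)\<close>. Then \<open>f (\<beta> (\<alpha> x)) x = f a b \<noteq> 0\<close>,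
  so \<open>\<beta> \<circ> \<alpha>\<close> is not commuting.
\<close>

section \<open>Subspaces and lines in finite dimension\<close>

lemma (in vectorspace) subspace_fin_dim:
  assumes "subspace K W V" and "fin_dim"
  shows "vectorspace.fin_dim K (vs W)"
proof -
  interpret W: vectorspace K "vs W" using assms(1) by (rule subspace_is_vs)
  have W: "submodule K W V" using assms(1) by simp
  then have sub: "W \<subseteq> carrier V" by (simp add: submodule_def)
  let ?P = "\<lambda>S. S \<subseteq> carrier (vs W) \<and> W.lin_indpt S"
  \<comment> \<open>A set independent in \<open>W\<close> is independent in \<open>V\<close>, so
    \<open>dim\<close> bounds its size; this makes a maximal independent subset of \<open>W\<close>
    exist, and that subset is a finite basis.\<close>
  have "finite S \<and> card S \<le> dim" if "?P S" for S
    using that li_le_dim[OF assms(2), of S] span_li_not_depend(2)[OF _ W, of S] sub by auto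
  moreover have "?P {}" by (auto simp: W.lin_dep_def)
  ultimately obtain A where "finite A" "maximal A ?P"
    using maximal_exists[of ?P dim "{}"] by blast
  then have "W.basis A" by (intro W.max_li_is_basis)
  with \<open>finite A\<close> show ?thesis unfolding W.fin_dim_def W.basis_def by blast
qed

lemma (in vectorspace) dim_one_generator:
  assumes "fin_dim" and "dim = 1"
  obtains v where "v \<in> carrier V" and "\<And>u. u \<in> carrier V \<Longrightarrow> \<exists>a\<in>carrier K. u = a \<odot>\<^bsub>V\<^esub> v"
proof -
  obtain B where B: "finite B" "basis B" using finite_basis_exists assms(1) by blast
  then have "card B = 1" using dim_basis assms(2) by simp
  then obtain v where v: "B = {v}" by (auto simp: card_1_singleton_iff)
  have vc: "v \<in> carrier V" and gen: "span {v} = carrier V"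
    using B(2) v by (auto simp: basis_def)
  have "\<exists>a\<in>carrier K. u = a \<odot>\<^bsub>V\<^esub> v" if u: "u \<in> carrier V" for u
  proof -
    obtain a where "a \<in> {v} \<rightarrow> carrier K" "lincomb a {v} = u"
      using finite_in_span[of "{v}" u] u vc gen by auto
    then show ?thesis using vc by (auto simp: lincomb_def)
  qed
  with vc show thesis using that by blast
qed

section \<open>Quotient modules and their dimension\<close>

context module
begin

text \<open>Negation is scalar multiplication by minus one, which a submodule absorbs. This opens
  the coset theory of abelian groups to submodules.\<close>

lemma submodule_abelian_subgroup:
  assumes "submodule R N M"
  shows "abelian_subgroup N M"
proof (rule abelian_subgroupI3)
  interpret N: submodule R N M by fact
  have "\<ominus>\<^bsub>M\<^esub> x \<in> N" if "x \<in> N" for x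
    using N.smult_closed[of "\<ominus>\<^bsub>R\<^esub> \<one>\<^bsub>R\<^esub>" x] smult_minus_1[of x] that subsetD[OF N.subset that]
    by simp
  then show "additive_subgroup N M"
    using N.subset
    by (intro additive_subgroup.intro add.subgroupI) (auto intro: N.zero_closed)
qed (rule M.abelian_group_axioms)

text \<open>All members of the coset of \<open>x\<close> give the same coset after scaling, so the
  union in \<open>quotient_space\<close> runs over a constant family; it is nonempty because
  \<open>x\<close> lies in its own coset.\<close>

lemma quotient_smult:
  assumes "submodule R N M" and "a \<in> carrier R" and "x \<in> carrier M"
  shows "a \<odot>\<^bsub>quotient_space M N\<^esub> (N +>\<^bsub>M\<^esub> x) = N +>\<^bsub>M\<^esub> (a \<odot>\<^bsub>M\<^esub> x)"
proof -
  interpret N: submodule R N M by fact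
  interpret G: abelian_subgroup N M using assms(1) by (rule submodule_abelian_subgroup)
  have "N +>\<^bsub>M\<^esub> (a \<odot>\<^bsub>M\<^esub> y) = N +>\<^bsub>M\<^esub> (a \<odot>\<^bsub>M\<^esub> x)" if y: "y \<in> N +>\<^bsub>M\<^esub> x" for y
  proof -
    obtain h where h: "h \<in> N" "y = h \<oplus>\<^bsub>M\<^esub> x" using y by (auto simp: a_r_coset_def')
    then have "a \<odot>\<^bsub>M\<^esub> y = a \<odot>\<^bsub>M\<^esub> h \<oplus>\<^bsub>M\<^esub> a \<odot>\<^bsub>M\<^esub> x"
      using assms N.subset by (auto simp: smult_r_distr)
    then have "a \<odot>\<^bsub>M\<^esub> y \<in> N +>\<^bsub>M\<^esub> (a \<odot>\<^bsub>M\<^esub> x)"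
      using assms h by (auto simp: a_r_coset_def')
    then show ?thesis
      using a_repr_independence[OF _ _ G.a_subgroup] assms by simp
  qed
  moreover have "x \<in> N +>\<^bsub>M\<^esub> x" using assms G.a_rcos_self by simp
  ultimately have "(\<Union>y\<in>N +>\<^bsub>M\<^esub> x. N +>\<^bsub>M\<^esub> (a \<odot>\<^bsub>M\<^esub> y)) = N +>\<^bsub>M\<^esub> (a \<odot>\<^bsub>M\<^esub> x)"
    by (intro SUP_eq_const) blast+
  then show ?thesis by (simp add: quotient_space_def)
qed

lemma quotient_add:
  assumes "submodule R N M" and "x \<in> carrier M" and "y \<in> carrier M"
  shows "(N +>\<^bsub>M\<^esub> x) \<oplus>\<^bsub>quotient_space M N\<^esub> (N +>\<^bsub>M\<^esub> y) = N +>\<^bsub>M\<^esub> (x \<oplus>\<^bsub>M\<^esub> y)"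
  using abelian_subgroup.a_rcos_sum[OF submodule_abelian_subgroup] assms
  by (simp add: quotient_space_def)

lemma quotient_carrier: "carrier (quotient_space M N) = (\<lambda>x. N +>\<^bsub>M\<^esub> x) ` carrier M"
  by (auto simp: quotient_space_def A_RCOSETS_def')

lemma quotient_zero:
  assumes "submodule R N M"
  shows "\<zero>\<^bsub>quotient_space M N\<^esub> = N +>\<^bsub>M\<^esub> \<zero>\<^bsub>M\<^esub>"
  using assms by (simp add: quotient_space_def submodule_def)

lemma quotient_module:
  assumes "submodule R N M"
  shows "module R (quotient_space M N)"
proof -
  have neg: "\<exists>y\<in>carrier M. N +>\<^bsub>M\<^esub> (x \<oplus>\<^bsub>M\<^esub> y) = N +>\<^bsub>M\<^esub> \<zero>\<^bsub>M\<^esub>" if "x \<in> carrier M" for x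
    using that by (intro bexI[of _ "\<ominus>\<^bsub>M\<^esub> x"]) (simp_all add: M.r_neg)
  show ?thesis
    using quotient_smult[OF assms] quotient_add[OF assms]
    by (intro module_criteria)
       (auto simp: quotient_carrier quotient_zero[OF assms] R.is_cring M.a_ac smult_assoc1
          smult_l_distr smult_r_distr neg)
qed

end

text \<open>The projection kills \<open>W\<close>, so the cosets of the members of \<open>S\<close>
  already generate the quotient, and a generating set bounds the dimension.\<close>

lemma (in vectorspace) quotient_dim_le:
  assumes "subspace K W V" and "finite S" and "S \<subseteq> carrier V"
    and gen: "\<And>u. u \<in> carrier V \<Longrightarrow> \<exists>z\<in>W. \<exists>s\<in>span S. u = z \<oplus>\<^bsub>V\<^esub> s"
  shows "vectorspace.dim K (quotient_space V W) \<le> card S"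
proof -
  have W: "submodule K W V" using assms(1) by simp
  interpret Q: vectorspace K "quotient_space V W"
    using quotient_module[OF W] by (simp add: vectorspace_def field_axioms)
  interpret G: abelian_subgroup W V using W by (rule submodule_abelian_subgroup)
  let ?q = "\<lambda>x. W +>\<^bsub>V\<^esub> x"
  interpret q: mod_hom K V "quotient_space V W" ?q
    by unfold_locales
      (auto simp: module_hom_def quotient_carrier quotient_add[OF W] quotient_smult[OF W])
  have sub: "?q ` S \<subseteq> carrier (quotient_space V W)"
    using assms(3) by (auto simp: quotient_carrier)
  have qspan: "?q s \<in> Q.span (?q ` S)" if "s \<in> span S" for s
  proof -
    \<comment> \<open>The preimage of the span of the cosets is a submodule containing
      \<open>S\<close>, hence contains \<open>span S\<close>.\<close>
    let ?N = "{s \<in> carrier V. ?q s \<in> Q.span (?q ` S)}"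
    interpret sp: submodule K "Q.span (?q ` S)" "quotient_space V W"
      using sub by (rule Q.span_is_submodule)
    have "submodule K ?N V"
      by unfold_locales auto
    moreover have "S \<subseteq> ?N" using Q.in_own_span[OF sub] assms(3) by auto
    ultimately have "span S \<subseteq> ?N" by (rule span_is_subset[rotated])
    then show ?thesis using that by auto
  qed
  have "?q u \<in> Q.span (?q ` S)" if u: "u \<in> carrier V" for u
  proof -
    obtain z s where zs: "z \<in> W" "s \<in> span S" "u = z \<oplus>\<^bsub>V\<^esub> s" using gen[OF u] by auto
    then have "s \<in> carrier V" using span_is_subset2[OF assms(3)] by auto
    then have "u \<in> ?q s" using zs by (auto simp: a_r_coset_def')
    then have "?q u = ?q s"
      using a_repr_independence[OF _ _ G.a_subgroup] \<open>s \<in> carrier V\<close> by simp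
    then show ?thesis using qspan zs by simp
  qed
  then have "Q.span (?q ` S) = carrier (quotient_space V W)"
    using Q.span_is_subset2[OF sub] by (auto simp: quotient_carrier)
  then have "Q.dim \<le> card (?q ` S)" using sub assms(2) by (intro Q.gen_ge_dim) auto
  also have "\<dots> \<le> card S" using assms(2) by (rule card_image_le)
  finally show ?thesis .
qed

section \<open>Brackets, center and derived subalgebra\<close>

context lie_algebra
begin

lemma bracket_anticommute:
  assumes "x \<in> carrier L" and "y \<in> carrier L"
  shows "bracket L x y = \<ominus> bracket L y x"
proof -
  have "\<zero> = bracket L (x \<oplus> y) (x \<oplus> y)"
    using assms by (simp add: bracket_self)
  also have "\<dots> = bracket L x y \<oplus> bracket L y x"
    using assms bracket_self[of x] bracket_self[of y]
    by (simp add: bracket_add_left bracket_add_right bracket_closed M.a_comm)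
  finally show ?thesis
    using assms by (metis bracket_closed M.minus_equality)
qed

lemma bracket_zero_left: "y \<in> carrier L \<Longrightarrow> bracket L \<zero> y = \<zero>"
  using bracket_smult_left[of "\<zero>\<^bsub>F\<^esub>" \<zero> y] by (simp add: bracket_closed)

lemma lie_center_subspace: "subspace F (lie_center L) L"
proof -
  have "submodule F (lie_center L) L"
    by unfold_locales
      (auto simp: lie_center_def bracket_add_left bracket_smult_left bracket_zero_left)
  then show ?thesis by (simp add: subspace_def vectorspace_axioms)
qed

lemma derived_subalgebra_subspace: "subspace F (derived_subalgebra F L) L"
  unfolding derived_subalgebra_def by (intro span_is_subspace) (auto intro: bracket_closed)

lemma bracket_in_derived:
  assumes "x \<in> carrier L" and "y \<in> carrier L"
  shows "bracket L x y \<in> derived_subalgebra F L"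
proof -
  let ?B = "{bracket L x y | x y. x \<in> carrier L \<and> y \<in> carrier L}"
  have "?B \<subseteq> span ?B" by (intro in_own_span) (auto intro: bracket_closed)
  with assms show ?thesis unfolding derived_subalgebra_def by blast
qed

text \<open>Modulo the center, \<open>x\<close> and \<open>p\<close> generate \<open>L\<close>. They
  may coincide or vanish, so the lemma serves both the abelian case and the case of an isotropic
  complement.\<close>

lemma center_index_le_two:
  assumes xp: "x \<in> carrier L" "p \<in> carrier L"
    and dec: "\<And>u. u \<in> carrier L \<Longrightarrow>
      \<exists>z\<in>lie_center L. \<exists>c\<in>carrier F. \<exists>d\<in>carrier F. u = z \<oplus> (c \<odot> x \<oplus> d \<odot> p)"
  shows "subspace_index F L (carrier L) (lie_center L) \<le> 2"
proof -
  have sub: "{x, p} \<subseteq> carrier L" using xp by simp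
  interpret S: submodule F "span {x, p}" L using sub by (rule span_is_submodule)
  have "\<exists>z\<in>lie_center L. \<exists>s\<in>span {x, p}. u = z \<oplus> s" if "u \<in> carrier L" for u
    using dec[OF that] in_own_span[OF sub] by blast
  then have "vectorspace.dim F (quotient_space L (lie_center L)) \<le> card {x, p}"
    using sub by (intro quotient_dim_le lie_center_subspace) auto
  also have "\<dots> \<le> 2" by (simp add: card_insert_if)
  finally show ?thesis by (simp add: subspace_index_def)
qed

end

section \<open>The bracket as a scalar-valued form\<close>

lemma (in heisenberg_lie_algebra) bracket_proportional:
  assumes "x \<in> carrier L" and "y \<in> carrier L" and nz: "bracket L x y \<noteq> \<zero>"
    and "u \<in> carrier L" and "v \<in> carrier L"
  shows "\<exists>a\<in>carrier F. bracket L u v = a \<odot> bracket L x y"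
proof -
  let ?D = "derived_subalgebra F L"
  interpret D: vectorspace F "vs ?D"
    using derived_subalgebra_subspace by (rule subspace_is_vs)
  have "D.fin_dim"
    using derived_subalgebra_subspace finite_dimensional by (rule subspace_fin_dim)
  then obtain z where z: "z \<in> ?D" "\<And>u. u \<in> ?D \<Longrightarrow> \<exists>a\<in>carrier F. u = a \<odot> z"
    using D.dim_one_generator dim_derived by auto
  have zL: "z \<in> carrier L" using z(1) derived_central by (auto simp: lie_center_def)
  obtain c where c: "c \<in> carrier F" "bracket L x y = c \<odot> z"
    using z(2) bracket_in_derived assms by blast
  \<comment> \<open>Dividing by \<open>c\<close> makes the nonzero bracket of \<open>x\<close> and
    \<open>y\<close> a generator of the derived line in place of \<open>z\<close>.\<close>
  then have "c \<noteq> \<zero>\<^bsub>F\<^esub>" using nz zL by auto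
  then have "z = inv\<^bsub>F\<^esub> c \<odot> bracket L x y" and ic: "inv\<^bsub>F\<^esub> c \<in> carrier F"
    using mult_inverse[OF c(1) zL] c by auto
  moreover obtain a where "a \<in> carrier F" "bracket L u v = a \<odot> z"
    using z(2) bracket_in_derived assms by blast
  ultimately have "bracket L u v = (a \<otimes>\<^bsub>F\<^esub> inv\<^bsub>F\<^esub> c) \<odot> bracket L x y"
    using assms by (simp add: smult_assoc1 bracket_closed)
  with ic \<open>a \<in> carrier F\<close> show ?thesis by blast
qed

text \<open>Linearity and skew-symmetry of \<open>f\<close> are not assumed: they descend from the
  bracket by cancelling the nonzero vector \<open>w\<close>.\<close>

locale lie_algebra_form = lie_algebra +
  fixes f :: "'c \<Rightarrow> 'c \<Rightarrow> 'a" and w :: 'c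
  assumes form_closed [simp]: "\<lbrakk>u \<in> carrier L; v \<in> carrier L\<rbrakk> \<Longrightarrow> f u v \<in> carrier F"
    and bracket_form: "\<lbrakk>u \<in> carrier L; v \<in> carrier L\<rbrakk> \<Longrightarrow> bracket L u v = f u v \<odot> w"
    and w_central: "w \<in> lie_center L"
    and w_nonzero: "w \<noteq> \<zero>"
begin

lemma w_closed [simp]: "w \<in> carrier L"
  using w_central by (simp add: lie_center_def)

lemma smult_w_cancel:
  assumes "a \<in> carrier F" and "b \<in> carrier F" and "a \<odot> w = b \<odot> w"
  shows "a = b"
proof (rule ccontr)
  assume "a \<noteq> b"
  then have "a \<ominus>\<^bsub>F\<^esub> b \<noteq> \<zero>\<^bsub>F\<^esub>" using assms by simp
  moreover have "(a \<ominus>\<^bsub>F\<^esub> b) \<odot> w = \<zero>"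
    using assms by (simp add: R.minus_eq smult_l_distr smult_l_minus M.r_neg)
  ultimately have "w = inv\<^bsub>F\<^esub> (a \<ominus>\<^bsub>F\<^esub> b) \<odot> \<zero>"
    using assms mult_inverse by (metis R.minus_closed w_closed)
  then show False
    using w_nonzero assms \<open>a \<ominus>\<^bsub>F\<^esub> b \<noteq> \<zero>\<^bsub>F\<^esub>\<close> by simp
qed

lemma form_eq_zero_iff:
  assumes "u \<in> carrier L" and "v \<in> carrier L"
  shows "f u v = \<zero>\<^bsub>F\<^esub> \<longleftrightarrow> bracket L u v = \<zero>"
  using smult_w_cancel[of "f u v" "\<zero>\<^bsub>F\<^esub>"] assms by (auto simp: bracket_form)

lemma form_self [simp]: "u \<in> carrier L \<Longrightarrow> f u u = \<zero>\<^bsub>F\<^esub>"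
  by (simp add: form_eq_zero_iff bracket_self)

lemma form_w [simp]: "v \<in> carrier L \<Longrightarrow> f w v = \<zero>\<^bsub>F\<^esub>"
  using w_central by (simp add: form_eq_zero_iff lie_center_def)

lemma form_skew:
  assumes "u \<in> carrier L" and "v \<in> carrier L"
  shows "f u v = \<ominus>\<^bsub>F\<^esub> f v u"
  using assms bracket_anticommute[of u v]
  by (intro smult_w_cancel) (simp_all add: bracket_form smult_l_minus)

lemma form_add_left:
  assumes "u \<in> carrier L" and "v \<in> carrier L" and "y \<in> carrier L"
  shows "f (u \<oplus> v) y = f u y \<oplus>\<^bsub>F\<^esub> f v y"
  using assms bracket_add_left[of u v y]
  by (intro smult_w_cancel) (simp_all add: bracket_form smult_l_distr)

lemma form_smult_left:
  assumes "a \<in> carrier F" and "u \<in> carrier L" and "y \<in> carrier L"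
  shows "f (a \<odot> u) y = a \<otimes>\<^bsub>F\<^esub> f u y"
  using assms bracket_smult_left[of a u y]
  by (intro smult_w_cancel) (simp_all add: bracket_form smult_assoc1)

text \<open>If \<open>f p q = 2\<close>, this map sends \<open>p\<close> and \<open>q\<close> to
  their negatives and fixes every vector orthogonal to both. The formula contains no division by 2,
  so characteristic 2 is covered. Restricting to the carrier makes the map extensional, as
  \<open>Bij\<close> demands.\<close>

definition involution :: "'c \<Rightarrow> 'c \<Rightarrow> 'c \<Rightarrow> 'c" where
  "involution p q = (\<lambda>u\<in>carrier L. u \<oplus> (f u p \<odot> q \<oplus> f q u \<odot> p))"

section \<open>Properties of the involutions\<close>

context
  fixes p q
  assumes p [simp]: "p \<in> carrier L" and q [simp]: "q \<in> carrier L"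
    and pq: "f p q = \<one>\<^bsub>F\<^esub> \<oplus>\<^bsub>F\<^esub> \<one>\<^bsub>F\<^esub>"
begin

lemma involution_closed [simp]: "u \<in> carrier L \<Longrightarrow> involution p q u \<in> carrier L"
  by (simp add: involution_def)

lemma form_involution:
  assumes "u \<in> carrier L" and "v \<in> carrier L"
  shows "f (involution p q u) v
    = f u v \<oplus>\<^bsub>F\<^esub> (f u p \<otimes>\<^bsub>F\<^esub> f q v \<oplus>\<^bsub>F\<^esub> f q u \<otimes>\<^bsub>F\<^esub> f p v)"
  using assms by (simp add: involution_def form_add_left form_smult_left)

text \<open>Since \<open>f q p = -2\<close>, the correction contributes \<open>-2 f u p\<close> and
  reverses the sign. The same count in the other slot gives the statement for
  \<open>q\<close>.\<close>

lemma form_involution_p: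
  assumes u [simp]: "u \<in> carrier L"
  shows "f (involution p q u) p = \<ominus>\<^bsub>F\<^esub> f u p"
proof -
  have "f q p = \<ominus>\<^bsub>F\<^esub> (\<one>\<^bsub>F\<^esub> \<oplus>\<^bsub>F\<^esub> \<one>\<^bsub>F\<^esub>)" using form_skew[of q p] pq by simp
  moreover have "c \<oplus>\<^bsub>F\<^esub> c \<otimes>\<^bsub>F\<^esub> (\<ominus>\<^bsub>F\<^esub> (\<one>\<^bsub>F\<^esub> \<oplus>\<^bsub>F\<^esub> \<one>\<^bsub>F\<^esub>)) = \<ominus>\<^bsub>F\<^esub> c" if "c \<in> carrier F" for c
    using that by algebra
  ultimately show ?thesis by (simp add: form_involution)
qed

lemma form_involution_q:
  assumes u [simp]: "u \<in> carrier L"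
  shows "f q (involution p q u) = \<ominus>\<^bsub>F\<^esub> f q u"
proof -
  have "f (involution p q u) q = f u q \<oplus>\<^bsub>F\<^esub> f q u \<otimes>\<^bsub>F\<^esub> (\<one>\<^bsub>F\<^esub> \<oplus>\<^bsub>F\<^esub> \<one>\<^bsub>F\<^esub>)"
    by (simp add: form_involution pq)
  moreover have "\<ominus>\<^bsub>F\<^esub> (\<ominus>\<^bsub>F\<^esub> c \<oplus>\<^bsub>F\<^esub> c \<otimes>\<^bsub>F\<^esub> (\<one>\<^bsub>F\<^esub> \<oplus>\<^bsub>F\<^esub> \<one>\<^bsub>F\<^esub>)) = \<ominus>\<^bsub>F\<^esub> c" if "c \<in> carrier F" for c
    using that by algebra
  ultimately show ?thesis
    using form_skew[of q "involution p q u"] form_skew[of u q] by simp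
qed

text \<open>The two correction terms are \<open>f u p\<close> times \<open>f q u\<close> and
  \<open>f q u\<close> times \<open>f p u\<close>; they cancel by skew-symmetry.\<close>

lemma form_involution_self:
  assumes u [simp]: "u \<in> carrier L"
  shows "f (involution p q u) u = \<zero>\<^bsub>F\<^esub>"
proof -
  have "f p u = \<ominus>\<^bsub>F\<^esub> f u p" by (simp add: form_skew[of p u])
  moreover have "c \<otimes>\<^bsub>F\<^esub> d \<oplus>\<^bsub>F\<^esub> d \<otimes>\<^bsub>F\<^esub> (\<ominus>\<^bsub>F\<^esub> c) = \<zero>\<^bsub>F\<^esub>" if "c \<in> carrier F" "d \<in> carrier F" for c d
    using that by algebra
  ultimately show ?thesis by (simp add: form_involution)
qed

text \<open>Expanding the first argument leaves products with \<open>f q ?v\<close> and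
  \<open>f p ?v\<close>, whose reversed signs cancel the correction hidden in
  \<open>f u ?v\<close>.\<close>

lemma form_involution_involution:
  assumes u [simp]: "u \<in> carrier L" and v [simp]: "v \<in> carrier L"
  shows "f (involution p q u) (involution p q v) = f u v"
proof -
  let ?v = "involution p q v"
  have 1: "f u ?v = \<ominus>\<^bsub>F\<^esub> (f v u \<oplus>\<^bsub>F\<^esub> (f v p \<otimes>\<^bsub>F\<^esub> f q u \<oplus>\<^bsub>F\<^esub> f q v \<otimes>\<^bsub>F\<^esub> f p u))"
    using form_skew[of u ?v] by (simp add: form_involution)
  have 2: "f p ?v = \<ominus>\<^bsub>F\<^esub> f p v"
    using form_skew[of p ?v] form_skew[of p v] form_involution_p[of v] by simp
  have skew: "f v u = \<ominus>\<^bsub>F\<^esub> f u v" "f v p = \<ominus>\<^bsub>F\<^esub> f p v" "f u p = \<ominus>\<^bsub>F\<^esub> f p u"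
    by (simp_all add: form_skew[of v u] form_skew[of v p] form_skew[of u p])
  \<comment> \<open>The letters \<open>a\<close>, \<open>b\<close>, \<open>c\<close>,
    \<open>d\<close>, \<open>e\<close> stand for \<open>f p v\<close>, \<open>f q u\<close>,
    \<open>f q v\<close>, \<open>f p u\<close>, \<open>f u v\<close>.\<close>
  have ring: "\<ominus>\<^bsub>F\<^esub> (\<ominus>\<^bsub>F\<^esub> e \<oplus>\<^bsub>F\<^esub> (\<ominus>\<^bsub>F\<^esub> a \<otimes>\<^bsub>F\<^esub> b \<oplus>\<^bsub>F\<^esub> c \<otimes>\<^bsub>F\<^esub> d))
      \<oplus>\<^bsub>F\<^esub> (\<ominus>\<^bsub>F\<^esub> d \<otimes>\<^bsub>F\<^esub> (\<ominus>\<^bsub>F\<^esub> c) \<oplus>\<^bsub>F\<^esub> b \<otimes>\<^bsub>F\<^esub> (\<ominus>\<^bsub>F\<^esub> a)) = e"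
    if "a \<in> carrier F" "b \<in> carrier F" "c \<in> carrier F" "d \<in> carrier F" "e \<in> carrier F"
    for a b c d e
    using that by algebra
  show ?thesis
    unfolding form_involution[OF u involution_closed[OF v]] form_involution_q[OF v] 1 2 skew
    by (rule ring) simp_all
qed

text \<open>Both coefficients change sign after one application, so the second subtracts exactly
  what the first added.\<close>

lemma involution_involutive:
  assumes u [simp]: "u \<in> carrier L"
  shows "involution p q (involution p q u) = u"
proof -
  let ?u = "involution p q u"
  have "involution p q ?u = ?u \<oplus> (\<ominus>\<^bsub>F\<^esub> f u p \<odot> q \<oplus> \<ominus>\<^bsub>F\<^esub> f q u \<odot> p)"
    using form_involution_p[of u] form_involution_q[of u]
    by (simp add: involution_def[of p q, THEN fun_cong, of ?u])
  also have "\<dots> = u \<oplus> ((f u p \<odot> q \<oplus> f q u \<odot> p) \<oplus> \<ominus> (f u p \<odot> q \<oplus> f q u \<odot> p))"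
    by (simp add: involution_def smult_l_minus M.minus_add M.a_assoc)
  finally show ?thesis by (simp add: M.r_neg)
qed

lemma involution_commuting: "involution p q \<in> commuting_autos F L"
proof -
  have "involution p q \<in> Bij (carrier L)"
    unfolding Bij_def
    by (auto simp: involution_involutive intro!: bij_betw_byWitness[where f' = "involution p q"])
       (simp add: involution_def)
  moreover have "involution p q \<in> module_hom F L L"
    unfolding module_hom_def
  proof (intro CollectI conjI allI impI; (elim conjE)?)
    show "involution p q \<in> carrier L \<rightarrow> carrier L" by simp
    fix u v assume [simp]: "u \<in> carrier L" "v \<in> carrier L"
    show "involution p q (u \<oplus> v) = involution p q u \<oplus> involution p q v"
      \<comment> \<open>Linearity is available in the left argument only, so \<open>f q\<close> is
        handled through skew-symmetry.\<close>
      using form_skew[of q "u \<oplus> v"] form_skew[of u q] form_skew[of v q]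
      by (simp add: involution_def form_add_left R.minus_add smult_l_distr M.a_ac)
  next
    fix a u assume [simp]: "a \<in> carrier F" "u \<in> carrier L"
    show "involution p q (a \<odot> u) = a \<odot> involution p q u"
      using form_skew[of q "a \<odot> u"] form_skew[of u q]
      by (simp add: involution_def form_smult_left smult_r_distr smult_assoc1[symmetric] R.r_minus)
  qed
  \<comment> \<open>The bracket is \<open>f u v\<close> times \<open>w\<close>, so invariance of
    \<open>f\<close> and of \<open>w\<close> together give compatibility with brackets;
    \<open>w\<close> is fixed because it is central.\<close>
  moreover have "involution p q w = w"
    using form_skew[of q w] by (simp add: involution_def)
  ultimately show ?thesis
    by (auto simp: commuting_autos_def lie_auto_def bracket_form form_involution_involution
        form_involution_self module_hom_smult)
qed

end

text \<open>The first involution sends \<open>x\<close> to the sum of \<open>x\<close> and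
  \<open>q\<close>, because \<open>f x p = 1\<close> and \<open>f q x = 0\<close>. Applying the
  second and pairing with \<open>x\<close> then yields \<open>f q r\<close>, which a commuting
  product would force to vanish.\<close>

lemma commuting_autos_not_subgroup:
  assumes [simp]: "x \<in> carrier L" "p \<in> carrier L" "q \<in> carrier L" "r \<in> carrier L"
    and pq: "f p q = \<one>\<^bsub>F\<^esub> \<oplus>\<^bsub>F\<^esub> \<one>\<^bsub>F\<^esub>" and pr: "f p r = \<one>\<^bsub>F\<^esub> \<oplus>\<^bsub>F\<^esub> \<one>\<^bsub>F\<^esub>"
    and xp: "f x p = \<one>\<^bsub>F\<^esub>" and qx: "f q x = \<zero>\<^bsub>F\<^esub>" and rx: "f r x = \<zero>\<^bsub>F\<^esub>" and qr: "f q r \<noteq> \<zero>\<^bsub>F\<^esub>"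
  shows "\<not> subgroup (commuting_autos F L) (LieAutoGroup F L)"
proof
  assume "subgroup (commuting_autos F L) (LieAutoGroup F L)"
  moreover have qc: "involution p q \<in> commuting_autos F L" and rc: "involution p r \<in> commuting_autos F L"
    using pq pr by (simp_all add: involution_commuting)
  ultimately have "involution p r \<otimes>\<^bsub>LieAutoGroup F L\<^esub> involution p q \<in> commuting_autos F L"
    by (simp add: subgroup.m_closed)
  \<comment> \<open>Multiplication in \<open>BijGroup\<close> is defined as composition only on
    bijections, so membership is needed to unfold it.\<close>
  moreover have "involution p q \<in> Bij (carrier L)" "involution p r \<in> Bij (carrier L)"
    using qc rc by (simp_all add: commuting_autos_def lie_auto_def)
  ultimately have "compose (carrier L) (involution p r) (involution p q) \<in> commuting_autos F L"
    by (simp add: LieAutoGroup_def BijGroup_def)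
  then have br: "bracket L (involution p r (involution p q x)) x = \<zero>"
    by (auto simp: commuting_autos_def compose_def)
  define v where "v = involution p q x"
  have [simp]: "v \<in> carrier L" by (simp add: v_def pq)
  have "f (involution p r v) x = \<zero>\<^bsub>F\<^esub>"
    using br pr by (simp add: form_eq_zero_iff v_def pq)
  moreover have "f (involution p r v) x = \<ominus>\<^bsub>F\<^esub> f r v"
    using form_skew[of p x] form_involution_self[of p q x]
    by (simp add: form_involution[of p r] pr rx xp pq R.r_minus flip: v_def)
  moreover have "f v r = f q r"
    using form_skew[of x r] by (simp add: v_def form_involution pq xp rx qx)
  ultimately show False using qr form_skew[of v r] by simp
qed

end

theorem theorem3p4:
  fixes F :: "('a, 'c) ring_scheme"
    and L :: "('a, 'b, 'd) lie_algebra_scheme"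
    and n :: nat
  assumes "heisenberg_lie_algebra F L"
    and "vectorspace.dim F L = n"
    and "n \<ge> 5"
    and "subspace_index F L (carrier L) (lie_center L) \<ge> 4"
  shows "\<not> subgroup (commuting_autos F L) (LieAutoGroup F L)"
proof -
  interpret heisenberg_lie_algebra F L by fact
  have "\<exists>x\<in>carrier L. \<exists>p\<in>carrier L. bracket L x p \<noteq> \<zero>\<^bsub>L\<^esub>"
  proof (rule ccontr)
    assume "\<not> ?thesis"
    then have "lie_center L = carrier L" by (auto simp: lie_center_def)
    \<comment> \<open>For abelian \<open>L\<close> each vector is its own central part, and zero
      vectors serve as generators.\<close>
    then have "subspace_index F L (carrier L) (lie_center L) \<le> 2"
      by (intro center_index_le_two[of "\<zero>\<^bsub>L\<^esub>" "\<zero>\<^bsub>L\<^esub>"])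
         (auto intro!: bexI[of _ "\<zero>\<^bsub>F\<^esub>"])
    with assms(4) show False by simp
  qed
  then obtain x p where xL [simp]: "x \<in> carrier L" and pL [simp]: "p \<in> carrier L"
    and nz: "bracket L x p \<noteq> \<zero>\<^bsub>L\<^esub>" by blast
  define w where "w = bracket L x p"
  \<comment> \<open>The coordinate of the bracket along \<open>w\<close>; taking \<open>w\<close> to
    be the bracket of \<open>x\<close> and \<open>p\<close> normalizes \<open>f x p\<close> to
    1.\<close>
  define f where "f = (\<lambda>u v. SOME a. a \<in> carrier F \<and> bracket L u v = a \<odot>\<^bsub>L\<^esub> w)"
  have f: "f u v \<in> carrier F \<and> bracket L u v = f u v \<odot>\<^bsub>L\<^esub> w"
    if "u \<in> carrier L" "v \<in> carrier L" for u v
  proof -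
    have "\<exists>a. a \<in> carrier F \<and> bracket L u v = a \<odot>\<^bsub>L\<^esub> w"
      using bracket_proportional[OF xL pL nz that] by (auto simp: w_def)
    then show ?thesis unfolding f_def by (rule someI_ex)
  qed
  have "w \<in> lie_center L" and "w \<noteq> \<zero>\<^bsub>L\<^esub>"
    using nz bracket_in_derived[of x p] derived_central by (auto simp: w_def)
  with f interpret lie_algebra_form F L f w
    by unfold_locales blast+
  have xp: "f x p = \<one>\<^bsub>F\<^esub>"
    using bracket_form[of x p] by (intro smult_w_cancel) (simp_all flip: w_def)
  have px: "f p x = \<ominus>\<^bsub>F\<^esub> \<one>\<^bsub>F\<^esub>" using form_skew[of p x] xp by simp
  have "\<exists>a\<in>carrier L. \<exists>b\<in>carrier L. f a x = \<zero>\<^bsub>F\<^esub> \<and> f a p = \<zero>\<^bsub>F\<^esub> \<and> f b x = \<zero>\<^bsub>F\<^esub> \<and> f b p = \<zero>\<^bsub>F\<^esub> \<and> f a b \<noteq> \<zero>\<^bsub>F\<^esub>"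
  proof (rule ccontr)
    assume isotropic: "\<not> ?thesis"
    \<comment> \<open>The projection to the orthogonal complement of \<open>x\<close> and
      \<open>p\<close> along their span. If the form vanished on that complement, every projected
      vector would be central and the index at most 2.\<close>
    define proj where "proj u = u \<oplus>\<^bsub>L\<^esub> (f p u \<odot>\<^bsub>L\<^esub> x \<oplus>\<^bsub>L\<^esub> f u x \<odot>\<^bsub>L\<^esub> p)" for u
    have proj_closed [simp]: "proj u \<in> carrier L" if "u \<in> carrier L" for u
      using that by (simp add: proj_def)
    have proj_form: "f (proj u) v = f u v \<oplus>\<^bsub>F\<^esub> (f p u \<otimes>\<^bsub>F\<^esub> f x v \<oplus>\<^bsub>F\<^esub> f u x \<otimes>\<^bsub>F\<^esub> f p v)"
      if "u \<in> carrier L" "v \<in> carrier L" for u v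
      using that by (simp add: proj_def form_add_left form_smult_left)
    have proj_x: "f (proj u) x = \<zero>\<^bsub>F\<^esub>" and proj_p: "f (proj u) p = \<zero>\<^bsub>F\<^esub>" if "u \<in> carrier L" for u
      using that form_skew[of p u] by (simp_all add: proj_form xp px R.r_minus R.r_neg)
    have "proj u \<in> lie_center L" if u [simp]: "u \<in> carrier L" for u
    proof -
      have "f (proj u) v = \<zero>\<^bsub>F\<^esub>" if v [simp]: "v \<in> carrier L" for v
      proof -
        \<comment> \<open>Replacing \<open>v\<close> by \<open>proj v\<close> does not change its
          pairing with \<open>proj u\<close>, which is orthogonal to \<open>x\<close> and
          \<open>p\<close>.\<close>
        have "f (proj v) (proj u) = \<zero>\<^bsub>F\<^esub>"
          using isotropic proj_x proj_p proj_closed u v by blast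
        moreover have "f x (proj u) = \<zero>\<^bsub>F\<^esub>" "f p (proj u) = \<zero>\<^bsub>F\<^esub>"
          using form_skew[of x "proj u"] form_skew[of p "proj u"] proj_x proj_p by simp_all
        ultimately have "f v (proj u) = \<zero>\<^bsub>F\<^esub>" by (simp add: proj_form)
        then show ?thesis using form_skew[of "proj u" v] by simp
      qed
      then show ?thesis by (simp add: lie_center_def bracket_form)
    qed
    moreover have "u = proj u \<oplus>\<^bsub>L\<^esub> (f u p \<odot>\<^bsub>L\<^esub> x \<oplus>\<^bsub>L\<^esub> f x u \<odot>\<^bsub>L\<^esub> p)" if u [simp]: "u \<in> carrier L" for u
    proof -
      have "f u p \<odot>\<^bsub>L\<^esub> x \<oplus>\<^bsub>L\<^esub> f x u \<odot>\<^bsub>L\<^esub> p = \<ominus>\<^bsub>L\<^esub> (f p u \<odot>\<^bsub>L\<^esub> x \<oplus>\<^bsub>L\<^esub> f u x \<odot>\<^bsub>L\<^esub> p)"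
        using form_skew[of u p] form_skew[of x u] by (simp add: smult_l_minus M.minus_add)
      then show ?thesis by (simp add: proj_def M.a_assoc M.r_neg)
    qed
    ultimately have "\<exists>z\<in>lie_center L. \<exists>c\<in>carrier F. \<exists>d\<in>carrier F.
        u = z \<oplus>\<^bsub>L\<^esub> (c \<odot>\<^bsub>L\<^esub> x \<oplus>\<^bsub>L\<^esub> d \<odot>\<^bsub>L\<^esub> p)" if "u \<in> carrier L" for u
      using that form_closed[OF that pL] form_closed[OF xL that] by blast
    then have "subspace_index F L (carrier L) (lie_center L) \<le> 2"
      by (rule center_index_le_two[OF xL pL])
    with assms(4) show False by simp
  qed
  then obtain a b where ab [simp]: "a \<in> carrier L" "b \<in> carrier L"
    and perp: "f a x = \<zero>\<^bsub>F\<^esub>" "f a p = \<zero>\<^bsub>F\<^esub>" "f b x = \<zero>\<^bsub>F\<^esub>" "f b p = \<zero>\<^bsub>F\<^esub>" and "f a b \<noteq> \<zero>\<^bsub>F\<^esub>"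
    by blast
  \<comment> \<open>Adding \<open>t = -2\<close> times \<open>x\<close> to \<open>a\<close> and
    \<open>b\<close> makes their pairings with \<open>p\<close> equal to \<open>-2\<close>, hence
    \<open>f p q\<close> and \<open>f p r\<close> equal to 2. Pairings with \<open>x\<close> remain
    zero, and \<open>f q r = f a b\<close> since \<open>a\<close> and \<open>b\<close> are
    orthogonal to \<open>x\<close>.\<close>
  define t where "t = \<ominus>\<^bsub>F\<^esub> (\<one>\<^bsub>F\<^esub> \<oplus>\<^bsub>F\<^esub> \<one>\<^bsub>F\<^esub>)"
  have t [simp]: "t \<in> carrier F" by (simp add: t_def)
  define q where "q = a \<oplus>\<^bsub>L\<^esub> t \<odot>\<^bsub>L\<^esub> x"
  define r where "r = b \<oplus>\<^bsub>L\<^esub> t \<odot>\<^bsub>L\<^esub> x"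
  have qr [simp]: "q \<in> carrier L" "r \<in> carrier L" by (simp_all add: q_def r_def)
  have fq: "f q v = f a v \<oplus>\<^bsub>F\<^esub> t \<otimes>\<^bsub>F\<^esub> f x v" and fr: "f r v = f b v \<oplus>\<^bsub>F\<^esub> t \<otimes>\<^bsub>F\<^esub> f x v"
    if "v \<in> carrier L" for v
    using that by (simp_all add: q_def r_def form_add_left form_smult_left)
  show ?thesis
  proof (rule commuting_autos_not_subgroup[of x p q r])
    show "f p q = \<one>\<^bsub>F\<^esub> \<oplus>\<^bsub>F\<^esub> \<one>\<^bsub>F\<^esub>" "f p r = \<one>\<^bsub>F\<^esub> \<oplus>\<^bsub>F\<^esub> \<one>\<^bsub>F\<^esub>"
      using form_skew[of p q] form_skew[of p r] by (simp_all add: fq fr perp xp t_def)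
    show rx: "f r x = \<zero>\<^bsub>F\<^esub>" and "f q x = \<zero>\<^bsub>F\<^esub>" by (simp_all add: fq fr perp)
    have "f x r = \<zero>\<^bsub>F\<^esub>" using form_skew[of x r] rx by simp
    moreover have "f a r = f a b"
      using form_skew[of a r] form_skew[of x a] form_skew[of a b] by (simp add: fr perp)
    ultimately show "f q r \<noteq> \<zero>\<^bsub>F\<^esub>" using \<open>f a b \<noteq> \<zero>\<^bsub>F\<^esub>\<close> by (simp add: fq)
  qed (simp_all add: xp)
qed

end
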